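(* There exist sequences $\{a_n\}_{n\ge1}\subset\mathbb C$, $\{\epsilon_n\}_{n\ge1}$ and $\{R_n\}_{n\ge1}$ of positive reals with $R_{n-1}<|a_n|<R_n$, together with a strictly decreasing sequence $\{\delta_n\}_{n\ge0}$ of positive reals with $\delta_0=1/4$, such that for every $n\ge1$, every holomorphic map $h\colon\overline{\mathbb C}\setminus\gamma_n^{-1}(\infty_2)\to\mathbb C^2$ with $\sup_{K_n}|\gamma_n-h|<\delta_n$ is an embedding on $K_{n-1}$, and $$\sup_{\overline{B_j(1/2)}}|f_n-\mathrm{id}|<\delta_j\cdot\frac1{2^{j+n}}\qquad\text{for all }0\le j<n.$$
   Context: $\overline{\mathbb C^2}=\mathbb C^2\cup\{\infty_2\}$. Set $D_n=\{|z|<R_n\}\subset\mathbb C$, $B_n=\overline D_n\times\overline D_n$ for $n\ge1$, and $B_0=\{(0,0)\}$. For $B\subset\mathbb C^2$ and $\alpha>0$, $B(\alpha)=\{z\in\mathbb C^2:\operatorname{dist}(z,B)<\alpha\}$ (Euclidean distance). Let $g_n(z)=\epsilon_n/(z-a_n)$, $f_n(x,y)=(x,y+g_n(x))$ for $n$ odd and $f_n(x,y)=(x+g_n(y),y)$ for $n$ even. Let $\gamma_n(z)=f_n\circ\cdots\circ f_1(z,0)$ for $z\in\mathbb C$, $\gamma_n(\infty)=\infty_2$, $K_n=\gamma_n^{-1}(B_n)\subset\overline{\mathbb C}$ for $n\ge1$, and $K_0=\emptyset$. Norms $|\cdot|$ on $\mathbb C^2$ are Euclidean. *)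

theory Defs
  imports "HOL-Analysis.Analysis"
begin

text \<open>C^2 is modelled as complex \<times> complex (its product norm is Euclidean).
  The point at infinity of C^2 (and of the Riemann sphere) is modelled by None.\<close>

definition Dn :: "(nat \<Rightarrow> real) \<Rightarrow> nat \<Rightarrow> complex set" where
  "Dn R n = ball 0 (R n)"

definition Bn :: "(nat \<Rightarrow> real) \<Rightarrow> nat \<Rightarrow> (complex \<times> complex) set" where
  "Bn R n = (if n = 0 then {(0,0)} else closure (Dn R n) \<times> closure (Dn R n))"

definition nbhd :: "(complex \<times> complex) set \<Rightarrow> real \<Rightarrow> (complex \<times> complex) set" where
  "nbhd B \<alpha> = {z. infdist z B < \<alpha>}"

definition fmap :: "(nat \<Rightarrow> complex) \<Rightarrow> (nat \<Rightarrow> real) \<Rightarrow> nat \<Rightarrow> complex \<times> complex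
    \<Rightarrow> (complex \<times> complex) option" where
  "fmap a \<epsilon> n p = (case p of (x, y) \<Rightarrow>
     (if odd n then (if x = a n then None else Some (x, y + complex_of_real (\<epsilon> n) / (x - a n)))
      else (if y = a n then None else Some (x + complex_of_real (\<epsilon> n) / (y - a n), y))))"

text \<open>gam n z = f_n o ... o f_1 (z,0), on the finite part of the Riemann sphere
  (gamma_n(infinity) = infinity_2 by definition).\<close>
fun gam :: "(nat \<Rightarrow> complex) \<Rightarrow> (nat \<Rightarrow> real) \<Rightarrow> nat \<Rightarrow> complex \<Rightarrow> (complex \<times> complex) option" where
  "gam a \<epsilon> 0 z = Some (z, 0)"
| "gam a \<epsilon> (Suc n) z = Option.bind (gam a \<epsilon> n z) (fmap a \<epsilon> (Suc n))"

text \<open>Riemann sphere minus gamma_n^{-1}(infinity_2); infinity is always removed.\<close>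
definition dom_gam :: "(nat \<Rightarrow> complex) \<Rightarrow> (nat \<Rightarrow> real) \<Rightarrow> nat \<Rightarrow> complex set" where
  "dom_gam a \<epsilon> n = {z. gam a \<epsilon> n z \<noteq> None}"

definition Kn :: "(nat \<Rightarrow> complex) \<Rightarrow> (nat \<Rightarrow> real) \<Rightarrow> (nat \<Rightarrow> real) \<Rightarrow> nat \<Rightarrow> complex set" where
  "Kn a \<epsilon> R n = (if n = 0 then {} else {z. \<exists>p. gam a \<epsilon> n z = Some p \<and> p \<in> Bn R n})"

definition holo2_on :: "(complex \<Rightarrow> complex \<times> complex) \<Rightarrow> complex set \<Rightarrow> bool" where
  "holo2_on h S \<longleftrightarrow> (\<lambda>z. fst (h z)) holomorphic_on S \<and> (\<lambda>z. snd (h z)) holomorphic_on S"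

definition embedding_on :: "(complex \<Rightarrow> complex \<times> complex) \<Rightarrow> complex set \<Rightarrow> bool" where
  "embedding_on h K \<longleftrightarrow> inj_on h K \<and>
     (\<forall>z\<in>K. (deriv (\<lambda>w. fst (h w)) z, deriv (\<lambda>w. snd (h w)) z) \<noteq> (0, 0))"

end

(*
  By Cauchy's estimate, a holomorphic perturbation that is uniformly delta-small on the
  r-neighbourhood of a compact set K has difference quotients of size O(delta/r) on K.
  An injective immersion G is characterised by the non-vanishing of the pair of difference
  quotients (including the diagonal, where they are derivatives), so by compactness of K x K
  they are bounded below by some m > 0; hence every h that is (m r/16)-close to G is again an
  embedding on K.

  gamma_n is an injective immersion of its domain (each f_n is a shear), K_n is compact because
  gamma_n tends to infinity at infinity and at every pole, and with a_k = 2k - 1, R_k = 2k and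
  eps_k <= 1 the set K_(n-1) lies in the interior of K_n.  This gives delta_n once
  eps_1, ..., eps_n are fixed; then eps_(n+1) = delta_n / 2^(2n+3) makes f_(n+1) move the points
  of B_j(1/2), j <= n, by at most 2 eps_(n+1) < delta_j / 2^(j+n+1), because there the pole
  coordinate stays at distance 1/2 from a_(n+1).
*)
theory Submission
  imports Defs "HOL-Complex_Analysis.Complex_Analysis"
begin

section \<open>Difference quotients and stability of embeddings\<close>

lemma holo2_on_imp_continuous_on: "holo2_on h S \<Longrightarrow> continuous_on S h"
  unfolding holo2_on_def
  using continuous_on_Pair[of S "\<lambda>z. fst (h z)" "\<lambda>z. snd (h z)"] holomorphic_on_imp_continuous_on
  by auto

lemma holo2_on_subset: "holo2_on h S \<Longrightarrow> T \<subseteq> S \<Longrightarrow> holo2_on h T"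
  unfolding holo2_on_def by (meson holomorphic_on_subset)

lemma embedding_on_subset: "embedding_on h S \<Longrightarrow> T \<subseteq> S \<Longrightarrow> embedding_on h T"
  unfolding embedding_on_def using inj_on_subset by blast

definition dquot :: "(complex \<Rightarrow> complex) \<Rightarrow> complex \<times> complex \<Rightarrow> complex" where
  "dquot f = (\<lambda>(z, w). if z = w then deriv f z else (f z - f w) / (z - w))"

lemma norm_dquot_minus_le:
  assumes holf: "f holomorphic_on U" and "open U" and "convex S" and "S \<subseteq> U"
    and bound: "\<And>u. u \<in> S \<Longrightarrow> norm (deriv f u - c) \<le> B" and "z \<in> S" "w \<in> S"
  shows "norm (dquot f (z, w) - c) \<le> B"
proof (cases "z = w")
  case True
  then show ?thesis using bound \<open>z \<in> S\<close> by (simp add: dquot_def)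
next
  case False
  have "norm ((f z - c * z) - (f w - c * w)) \<le> B * norm (z - w)"
  proof (rule field_differentiable_bound[OF \<open>convex S\<close>])
    fix u assume "u \<in> S"
    then have "(f has_field_derivative deriv f u) (at u within S)"
      using holomorphic_derivI[OF holf \<open>open U\<close>] \<open>S \<subseteq> U\<close> by blast
    then show "((\<lambda>u. f u - c * u) has_field_derivative deriv f u - c) (at u within S)"
      by (auto intro!: derivative_eq_intros)
  qed (use bound \<open>z \<in> S\<close> \<open>w \<in> S\<close> in auto)
  moreover have "(f z - f w) / (z - w) - c = ((f z - c * z) - (f w - c * w)) / (z - w)"
    using False by (simp add: field_simps)
  ultimately show ?thesis
    using False by (simp add: dquot_def norm_divide divide_le_eq)
qed

lemma isCont_dquot_off_diagonal:
  assumes holf: "f holomorphic_on U" and "open U" "z0 \<in> U" "w0 \<in> U" "z0 \<noteq> w0"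
  shows "isCont (dquot f) (z0, w0)"
proof -
  let ?q = "\<lambda>p. (f (fst p) - f (snd p)) / (fst p - snd p)"
  have "isCont f z0" "isCont f w0"
    using assms holomorphic_on_imp_continuous_on[OF holf] by (auto simp: continuous_on_eq_continuous_at)
  then have cont_q: "isCont ?q (z0, w0)"
    using \<open>z0 \<noteq> w0\<close> by (intro continuous_intros isCont_o2[where f=fst] isCont_o2[where f=snd]) auto
  have "eventually (\<lambda>p. p \<in> {p. fst p \<noteq> snd p}) (nhds (z0, w0))"
    using \<open>z0 \<noteq> w0\<close> by (intro eventually_nhds_in_open open_Collect_neq continuous_intros) auto
  then have near: "eventually (\<lambda>p. dquot f p = ?q p) (nhds (z0, w0))"
    by (rule eventually_mono) (auto simp: dquot_def)
  show ?thesis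
    using isCont_cong[OF near] cont_q by simp
qed

lemma isCont_dquot_diagonal:
  assumes holf: "f holomorphic_on U" and "open U" "z0 \<in> U"
  shows "isCont (dquot f) (z0, z0)"
  unfolding continuous_at_eps_delta
proof (intro allI impI)
  fix e :: real assume "e > 0"
  have "isCont (deriv f) z0"
    using holomorphic_deriv[OF holf \<open>open U\<close>] assms holomorphic_on_imp_continuous_on
      continuous_on_eq_continuous_at by blast
  then obtain d1 where "d1 > 0" and d1: "\<And>u. dist u z0 < d1 \<Longrightarrow> dist (deriv f u) (deriv f z0) < e / 2"
    using \<open>e > 0\<close> unfolding continuous_at_eps_delta by (metis half_gt_zero)
  obtain d2 where "d2 > 0" "ball z0 d2 \<subseteq> U"
    using \<open>open U\<close> \<open>z0 \<in> U\<close> open_contains_ball by blast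
  define d where "d = min d1 d2"
  have "dist (dquot f p) (dquot f (z0, z0)) < e" if "dist p (z0, z0) < d" for p
  proof -
    have "fst p \<in> ball z0 d" "snd p \<in> ball z0 d"
      using that dist_fst_le[of p "(z0, z0)"] dist_snd_le[of p "(z0, z0)"] by (auto simp: dist_commute)
    moreover have "norm (deriv f u - deriv f z0) \<le> e / 2" if "u \<in> ball z0 d" for u
      using d1[of u] that by (simp add: d_def dist_norm norm_minus_commute)
    ultimately have "norm (dquot f (fst p, snd p) - deriv f z0) \<le> e / 2"
      using \<open>ball z0 d2 \<subseteq> U\<close>
      by (intro norm_dquot_minus_le[OF holf \<open>open U\<close> convex_ball[of z0 d]]) (auto simp: d_def)
    then show ?thesis
      using \<open>e > 0\<close> by (simp add: dquot_def dist_norm)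
  qed
  then show "\<exists>d>0. \<forall>p. dist p (z0, z0) < d \<longrightarrow> dist (dquot f p) (dquot f (z0, z0)) < e"
    using \<open>d1 > 0\<close> \<open>d2 > 0\<close> by (intro exI[of _ d]) (auto simp: d_def)
qed

lemma continuous_on_dquot:
  assumes "f holomorphic_on U" and "open U"
  shows "continuous_on (U \<times> U) (dquot f)"
proof -
  have "isCont (dquot f) (z, w)" if "z \<in> U" "w \<in> U" for z w
    using assms that by (cases "z = w") (auto intro: isCont_dquot_diagonal isCont_dquot_off_diagonal)
  then show ?thesis
    by (auto intro: continuous_at_imp_continuous_on)
qed

lemma embedding_on_iff_dquot:
  "embedding_on h K \<longleftrightarrow>
     (\<forall>z\<in>K. \<forall>w\<in>K. (dquot (\<lambda>u. fst (h u)) (z, w), dquot (\<lambda>u. snd (h u)) (z, w)) \<noteq> (0, 0))"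
    (is "_ \<longleftrightarrow> (\<forall>z\<in>K. \<forall>w\<in>K. ?Q z w \<noteq> (0, 0))")
proof -
  have off_diag: "?Q z w = (0, 0) \<longleftrightarrow> h z = h w" if "z \<noteq> w" for z w
    using that by (simp add: dquot_def prod_eq_iff)
  have diag: "?Q z z = (deriv (\<lambda>u. fst (h u)) z, deriv (\<lambda>u. snd (h u)) z)" for z
    by (simp add: dquot_def)
  show ?thesis
  proof
    assume emb: "embedding_on h K"
    show "\<forall>z\<in>K. \<forall>w\<in>K. ?Q z w \<noteq> (0, 0)"
    proof (intro ballI)
      fix z w assume "z \<in> K" "w \<in> K"
      show "?Q z w \<noteq> (0, 0)"
      proof (cases "z = w")
        case True
        then show ?thesis
          using emb \<open>z \<in> K\<close> by (simp only: diag embedding_on_def) blast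
      next
        case False
        then show ?thesis
          using emb \<open>z \<in> K\<close> \<open>w \<in> K\<close> off_diag[OF False] by (auto simp: embedding_on_def dest: inj_onD)
      qed
    qed
  next
    assume nz: "\<forall>z\<in>K. \<forall>w\<in>K. ?Q z w \<noteq> (0, 0)"
    then have "inj_on h K"
      unfolding inj_on_def using off_diag by blast
    moreover have "(deriv (\<lambda>u. fst (h u)) z, deriv (\<lambda>u. snd (h u)) z) \<noteq> (0, 0)" if "z \<in> K" for z
      using nz that unfolding diag[symmetric] by blast
    ultimately show "embedding_on h K"
      by (simp add: embedding_on_def)
  qed
qed

lemma embedding_on_dquot_lower_bound:
  assumes G: "holo2_on G U" and "open U" "compact K" "K \<subseteq> U" and "embedding_on G K"
  obtains m where "m > 0" and "\<And>z w. z \<in> K \<Longrightarrow> w \<in> K \<Longrightarrow>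
    m \<le> norm (dquot (\<lambda>u. fst (G u)) (z, w)) + norm (dquot (\<lambda>u. snd (G u)) (z, w))"
proof (cases "K = {}")
  case True
  then show ?thesis using that[of 1] by simp
next
  case False
  define F where "F p = norm (dquot (\<lambda>u. fst (G u)) p) + norm (dquot (\<lambda>u. snd (G u)) p)" for p
  have "continuous_on (U \<times> U) F"
    using G \<open>open U\<close> unfolding F_def holo2_on_def by (intro continuous_intros continuous_on_dquot) auto
  then have "continuous_on (K \<times> K) F"
    by (rule continuous_on_subset) (use \<open>K \<subseteq> U\<close> in auto)
  then obtain p0 where p0: "p0 \<in> K \<times> K" and min: "\<And>p. p \<in> K \<times> K \<Longrightarrow> F p0 \<le> F p"
    using continuous_attains_inf[of "K \<times> K" F] \<open>compact K\<close> False by (auto simp: compact_Times)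
  have "F p0 > 0"
  proof -
    obtain z w where "p0 = (z, w)" "z \<in> K" "w \<in> K"
      using p0 by auto
    then have "dquot (\<lambda>u. fst (G u)) p0 \<noteq> 0 \<or> dquot (\<lambda>u. snd (G u)) p0 \<noteq> 0"
      using \<open>embedding_on G K\<close> unfolding embedding_on_iff_dquot by auto
    then show ?thesis
      unfolding F_def by (metis add_pos_nonneg add_nonneg_pos norm_ge_zero zero_less_norm_iff)
  qed
  then show ?thesis
    using that[of "F p0"] min by (auto simp: F_def)
qed

lemma dquot_diff:
  assumes "f holomorphic_on U" "g holomorphic_on U" "open U" "z \<in> U"
  shows "dquot (\<lambda>u. f u - g u) (z, w) = dquot f (z, w) - dquot g (z, w)"
proof (cases "z = w")
  case True
  have "f field_differentiable at z" "g field_differentiable at z"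
    using assms holomorphic_on_imp_differentiable_at by blast+
  then show ?thesis
    using True by (simp add: dquot_def)
next
  case False
  then show ?thesis by (simp add: dquot_def diff_divide_distrib)
qed

lemma norm_deriv_le_Cauchy:
  assumes holf: "f holomorphic_on U" and "cball u \<rho> \<subseteq> U" and "\<rho> > 0"
    and bound: "\<And>x. x \<in> cball u \<rho> \<Longrightarrow> norm (f x) \<le> B"
  shows "norm (deriv f u) \<le> B / \<rho>"
proof -
  have "norm ((deriv ^^ 1) f u) \<le> fact 1 * B / \<rho> ^ 1"
  proof (rule Cauchy_inequality)
    show "f holomorphic_on ball u \<rho>"
      by (rule holomorphic_on_subset[OF holf]) (use assms(2) ball_subset_cball in blast)
    show "continuous_on (cball u \<rho>) f"
      by (rule holomorphic_on_imp_continuous_on, rule holomorphic_on_subset[OF holf assms(2)])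
    show "norm (f x) \<le> B" if "norm (u - x) = \<rho>" for x
      using that bound by (simp add: dist_norm)
  qed fact
  then show ?thesis by simp
qed

lemma norm_deriv_le_thickening:
  assumes holf: "f holomorphic_on U" and "r > 0"
    and sub: "(\<Union>z\<in>K. cball z r) \<subseteq> U"
    and bound: "\<And>u. u \<in> (\<Union>z\<in>K. cball z r) \<Longrightarrow> norm (f u) \<le> B"
    and "z \<in> K" "u \<in> cball z (r / 2)"
  shows "norm (deriv f u) \<le> 2 * B / r"
proof -
  have "cball u (r / 2) \<subseteq> cball z r"
    using \<open>u \<in> cball z (r / 2)\<close> by (subst cball_subset_cball_iff) (simp add: dist_commute)
  then have ball_sub: "cball u (r / 2) \<subseteq> (\<Union>z\<in>K. cball z r)"
    using \<open>z \<in> K\<close> by blast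
  have "norm (deriv f u) \<le> B / (r / 2)"
  proof (rule norm_deriv_le_Cauchy[OF holf])
    show "cball u (r / 2) \<subseteq> U"
      using ball_sub sub by blast
    show "norm (f x) \<le> B" if "x \<in> cball u (r / 2)" for x
      using that ball_sub bound by blast
  qed (use \<open>r > 0\<close> in simp)
  then show ?thesis by (simp add: mult.commute)
qed

lemma norm_dquot_le_sup:
  assumes holf: "f holomorphic_on U" and "open U" and "r > 0"
    and sub: "(\<Union>z\<in>K. cball z r) \<subseteq> U"
    and bound: "\<And>u. u \<in> (\<Union>z\<in>K. cball z r) \<Longrightarrow> norm (f u) \<le> B"
    and "z \<in> K" "w \<in> K"
  shows "norm (dquot f (z, w)) \<le> 4 * B / r"
proof -
  have near: "x \<in> (\<Union>z\<in>K. cball z r)" if "x \<in> K" for x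
    using that \<open>r > 0\<close> by (intro UN_I[of x]) auto
  have "0 \<le> B"
    using bound[OF near[OF \<open>z \<in> K\<close>]] norm_ge_zero[of "f z"] by linarith
  show ?thesis
  proof (cases "norm (z - w) \<le> r / 2")
    case True
    have "cball z (r / 2) \<subseteq> cball z r"
      using \<open>r > 0\<close> by (intro subset_cball) simp
    then have "cball z (r / 2) \<subseteq> U"
      using sub \<open>z \<in> K\<close> by blast
    then have "norm (dquot f (z, w) - 0) \<le> 2 * B / r"
      using True norm_deriv_le_thickening[OF holf \<open>r > 0\<close> sub bound \<open>z \<in> K\<close>] \<open>r > 0\<close>
      by (intro norm_dquot_minus_le[OF holf \<open>open U\<close> convex_cball]) (auto simp: dist_norm norm_minus_commute)
    also have "\<dots> \<le> 4 * B / r"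
      using \<open>0 \<le> B\<close> \<open>r > 0\<close> by (simp add: divide_right_mono)
    finally show ?thesis by simp
  next
    case False
    have "norm (f z - f w) \<le> 2 * B"
      using bound[OF near[OF \<open>z \<in> K\<close>]] bound[OF near[OF \<open>w \<in> K\<close>]]
        norm_triangle_ineq4[of "f z" "f w"] by linarith
    have "z \<noteq> w"
      using False \<open>r > 0\<close> by auto
    then have "norm (dquot f (z, w)) = norm (f z - f w) / norm (z - w)"
      by (simp add: dquot_def norm_divide)
    also have "\<dots> \<le> 2 * B / norm (z - w)"
      using \<open>norm (f z - f w) \<le> 2 * B\<close> by (simp add: divide_right_mono)
    also have "\<dots> \<le> 2 * B / (r / 2)"
      using False \<open>0 \<le> B\<close> \<open>r > 0\<close> by (intro divide_left_mono) (auto simp: zero_less_mult_iff)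
    finally show ?thesis by simp
  qed
qed

lemma norm_dquot_le_perturbed:
  assumes "g holomorphic_on U" "f holomorphic_on U" "open U" "r > 0"
    and "(\<Union>z\<in>K. cball z r) \<subseteq> U"
    and "\<And>u. u \<in> (\<Union>z\<in>K. cball z r) \<Longrightarrow> norm (g u - f u) \<le> B"
    and "z \<in> K" "w \<in> K"
  shows "norm (dquot g (z, w)) \<le> norm (dquot f (z, w)) + 4 * B / r"
proof -
  have "z \<in> (\<Union>z\<in>K. cball z r)"
    using \<open>z \<in> K\<close> \<open>r > 0\<close> by (intro UN_I[of z]) auto
  then have "z \<in> U"
    using assms(5) by blast
  then have "norm (dquot g (z, w) - dquot f (z, w)) = norm (dquot (\<lambda>u. g u - f u) (z, w))"
    by (simp add: dquot_diff[OF assms(1-3)])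
  also have "\<dots> \<le> 4 * B / r"
    using assms by (intro norm_dquot_le_sup[where U=U and K=K]) (auto intro!: holomorphic_intros)
  finally show ?thesis
    using norm_triangle_sub[of "dquot g (z, w)" "dquot f (z, w)"] by linarith
qed

lemma embedding_on_perturbation:
  assumes G: "holo2_on G U" and "open U" "compact K" "r > 0"
    and KL: "(\<Union>z\<in>K. cball z r) \<subseteq> L" and "L \<subseteq> U" and "embedding_on G K"
  obtains \<delta> where "\<delta> > 0"
    and "\<And>h. holo2_on h U \<Longrightarrow> (\<And>z. z \<in> L \<Longrightarrow> norm (G z - h z) < \<delta>) \<Longrightarrow> embedding_on h K"
proof -
  have "K \<subseteq> (\<Union>z\<in>K. cball z r)"
    using \<open>r > 0\<close> by auto
  then have "K \<subseteq> U"
    using KL \<open>L \<subseteq> U\<close> by blast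
  obtain m where "m > 0" and m: "\<And>z w. z \<in> K \<Longrightarrow> w \<in> K \<Longrightarrow>
      m \<le> norm (dquot (\<lambda>u. fst (G u)) (z, w)) + norm (dquot (\<lambda>u. snd (G u)) (z, w))"
    using embedding_on_dquot_lower_bound[OF G \<open>open U\<close> \<open>compact K\<close> \<open>K \<subseteq> U\<close> \<open>embedding_on G K\<close>]
    by blast
  have KU: "(\<Union>z\<in>K. cball z r) \<subseteq> U"
    using KL \<open>L \<subseteq> U\<close> by blast
  \<comment> \<open>By Cauchy's estimate the difference quotients of G - h are at most 4 \<delta> / r = m / 4 on K.\<close>
  define \<delta> where "\<delta> = m * r / 16"
  have "embedding_on h K"
    if h: "holo2_on h U" and close: "\<And>z. z \<in> L \<Longrightarrow> norm (G z - h z) < \<delta>" for h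
  proof -
    have close_coords: "norm (fst (G u) - fst (h u)) \<le> \<delta>" "norm (snd (G u) - snd (h u)) \<le> \<delta>"
      if "u \<in> (\<Union>z\<in>K. cball z r)" for u
    proof -
      have "norm (G u - h u) < \<delta>"
        using that KL close by blast
      then show "norm (fst (G u) - fst (h u)) \<le> \<delta>" "norm (snd (G u) - snd (h u)) \<le> \<delta>"
        using dist_fst_le[of "G u" "h u"] dist_snd_le[of "G u" "h u"] by (simp_all add: dist_norm)
    qed
    have "0 < norm (dquot (\<lambda>u. fst (h u)) (z, w)) + norm (dquot (\<lambda>u. snd (h u)) (z, w))"
      if "z \<in> K" "w \<in> K" for z w
    proof -
      have "norm (dquot (\<lambda>u. fst (G u)) (z, w)) \<le> norm (dquot (\<lambda>u. fst (h u)) (z, w)) + 4 * \<delta> / r"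
        "norm (dquot (\<lambda>u. snd (G u)) (z, w)) \<le> norm (dquot (\<lambda>u. snd (h u)) (z, w)) + 4 * \<delta> / r"
        using G h unfolding holo2_on_def
        by (auto intro!: norm_dquot_le_perturbed[OF _ _ \<open>open U\<close> \<open>r > 0\<close> KU close_coords(1)]
            norm_dquot_le_perturbed[OF _ _ \<open>open U\<close> \<open>r > 0\<close> KU close_coords(2)] that)
      moreover have "4 * \<delta> / r = m / 4"
        using \<open>r > 0\<close> by (simp add: \<delta>_def)
      ultimately show ?thesis
        using m[OF that] \<open>m > 0\<close> by linarith
    qed
    then show ?thesis
      unfolding embedding_on_iff_dquot by (metis add.right_neutral less_irrefl norm_zero prod.inject)
  qed
  moreover have "\<delta> > 0"
    using \<open>m > 0\<close> \<open>r > 0\<close> by (simp add: \<delta>_def)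
  ultimately show thesis
    using that by blast
qed

section \<open>The maps gamma_n\<close>

definition pole_coord :: "nat \<Rightarrow> complex \<times> complex \<Rightarrow> complex" where
  "pole_coord n p = (if odd n then fst p else snd p)"

definition free_coord :: "nat \<Rightarrow> complex \<times> complex \<Rightarrow> complex" where
  "free_coord n p = (if odd n then snd p else fst p)"

(* At a pole (pole_coord n p = a n) the division by zero makes shear return junk;
   fmap_eq_shear shows that fmap excludes exactly these points. *)
definition shear :: "(nat \<Rightarrow> complex) \<Rightarrow> (nat \<Rightarrow> real) \<Rightarrow> nat \<Rightarrow> complex \<times> complex \<Rightarrow> complex \<times> complex" where
  "shear a \<epsilon> n p = (if odd n then (fst p, snd p + of_real (\<epsilon> n) / (fst p - a n))
                    else (fst p + of_real (\<epsilon> n) / (snd p - a n), snd p))"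

lemma pole_coord_shear [simp]: "pole_coord n (shear a \<epsilon> n p) = pole_coord n p"
  and free_coord_shear [simp]:
    "free_coord n (shear a \<epsilon> n p) = free_coord n p + of_real (\<epsilon> n) / (pole_coord n p - a n)"
  by (simp_all add: pole_coord_def free_coord_def shear_def)

lemma coord_parity:
  "odd k = odd n \<Longrightarrow> pole_coord k = pole_coord n \<and> free_coord k = free_coord n"
  "odd k \<noteq> odd n \<Longrightarrow> pole_coord k = free_coord n \<and> free_coord k = pole_coord n"
  by (auto simp: pole_coord_def free_coord_def fun_eq_iff)

lemma norm_coord_le: "norm (pole_coord n p) \<le> norm p" "norm (free_coord n p) \<le> norm p"
  using norm_fst_le[of "fst p" "snd p"] norm_snd_le[of "snd p" "fst p"]
  by (simp_all add: pole_coord_def free_coord_def)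

lemma fmap_eq_shear: "fmap a \<epsilon> n p = (if pole_coord n p = a n then None else Some (shear a \<epsilon> n p))"
  by (cases p) (simp add: fmap_def shear_def pole_coord_def)

lemma inj_shear: "inj (shear a \<epsilon> n)"
  by (rule injI) (auto simp: shear_def prod_eq_iff split: if_splits)

lemma holo2_on_coord:
  assumes "holo2_on h S"
  shows "(\<lambda>z. pole_coord n (h z)) holomorphic_on S" "(\<lambda>z. free_coord n (h z)) holomorphic_on S"
  using assms by (cases "odd n"; simp add: holo2_on_def pole_coord_def free_coord_def)+

lemma holo2_on_shear:
  assumes "holo2_on g S" and "\<And>z. z \<in> S \<Longrightarrow> pole_coord n (g z) \<noteq> a n"
  shows "holo2_on (\<lambda>z. shear a \<epsilon> n (g z)) S"
  using assms unfolding holo2_on_def shear_def pole_coord_def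
  by (cases "odd n") (auto intro!: holomorphic_intros)

lemma deriv_pair_nonzero_iff_coords:
  "(deriv (\<lambda>u. fst (h u)) z, deriv (\<lambda>u. snd (h u)) z) \<noteq> (0, 0) \<longleftrightarrow>
   (deriv (\<lambda>u. pole_coord n (h u)) z, deriv (\<lambda>u. free_coord n (h u)) z) \<noteq> (0, 0)"
  by (cases "odd n") (auto simp: pole_coord_def free_coord_def)

lemma embedding_on_shear:
  assumes hol: "holo2_on g S" and "open S" and emb: "embedding_on g S"
    and pole: "\<And>z. z \<in> S \<Longrightarrow> pole_coord n (g z) \<noteq> a n"
  shows "embedding_on (\<lambda>z. shear a \<epsilon> n (g z)) S"
proof -
  have "inj_on g S"
    using emb by (simp add: embedding_on_def)
  then have "inj_on (\<lambda>z. shear a \<epsilon> n (g z)) S"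
    using comp_inj_on[OF _ inj_on_subset[OF inj_shear subset_UNIV]] by (simp add: o_def)
  moreover have "(deriv (\<lambda>u. fst (shear a \<epsilon> n (g u))) z, deriv (\<lambda>u. snd (shear a \<epsilon> n (g u))) z)
      \<noteq> (0, 0)" if "z \<in> S" for z
  proof -
    let ?P = "\<lambda>u. pole_coord n (g u)" and ?F = "\<lambda>u. free_coord n (g u)"
    have "(?P has_field_derivative deriv ?P z) (at z)" "(?F has_field_derivative deriv ?F z) (at z)"
      using holo2_on_coord[OF hol] \<open>open S\<close> that holomorphic_derivI by blast+
    then have "((\<lambda>u. ?F u + of_real (\<epsilon> n) / (?P u - a n)) has_field_derivative
        deriv ?F z - of_real (\<epsilon> n) * deriv ?P z / (?P z - a n)^2) (at z)"
      using pole[OF that] by (auto intro!: derivative_eq_intros simp: power2_eq_square field_simps)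
    then have "deriv (\<lambda>u. free_coord n (shear a \<epsilon> n (g u))) z
        = deriv ?F z - of_real (\<epsilon> n) * deriv ?P z / (?P z - a n)^2"
      by (simp add: DERIV_imp_deriv)
    moreover have "deriv (\<lambda>u. pole_coord n (shear a \<epsilon> n (g u))) z = deriv ?P z"
      by simp
    moreover have "(deriv ?P z, deriv ?F z) \<noteq> (0, 0)"
      using emb that deriv_pair_nonzero_iff_coords[of g z n] by (simp add: embedding_on_def)
    ultimately have "(deriv (\<lambda>u. pole_coord n (shear a \<epsilon> n (g u))) z,
                      deriv (\<lambda>u. free_coord n (shear a \<epsilon> n (g u))) z) \<noteq> (0, 0)"
      by (cases "deriv ?P z = 0") simp_all
    then show ?thesis
      using deriv_pair_nonzero_iff_coords[of "\<lambda>u. shear a \<epsilon> n (g u)" z n] by blast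
  qed
  ultimately show ?thesis
    unfolding embedding_on_def by blast
qed

primrec gamma_map :: "(nat \<Rightarrow> complex) \<Rightarrow> (nat \<Rightarrow> real) \<Rightarrow> nat \<Rightarrow> complex \<Rightarrow> complex \<times> complex" where
  "gamma_map a \<epsilon> 0 z = (z, 0)"
| "gamma_map a \<epsilon> (Suc n) z = shear a \<epsilon> (Suc n) (gamma_map a \<epsilon> n z)"

primrec gamma_dom :: "(nat \<Rightarrow> complex) \<Rightarrow> (nat \<Rightarrow> real) \<Rightarrow> nat \<Rightarrow> complex set" where
  "gamma_dom a \<epsilon> 0 = UNIV"
| "gamma_dom a \<epsilon> (Suc n) =
     {z \<in> gamma_dom a \<epsilon> n. pole_coord (Suc n) (gamma_map a \<epsilon> n z) \<noteq> a (Suc n)}"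

lemma gamma_map_Suc_eq: "gamma_map a \<epsilon> (Suc n) = (\<lambda>z. shear a \<epsilon> (Suc n) (gamma_map a \<epsilon> n z))"
  by (simp add: fun_eq_iff)

lemma gam_eq: "gam a \<epsilon> n z = (if z \<in> gamma_dom a \<epsilon> n then Some (gamma_map a \<epsilon> n z) else None)"
  by (induction n) (simp_all add: fmap_eq_shear)

lemma dom_gam_eq: "dom_gam a \<epsilon> n = gamma_dom a \<epsilon> n"
  by (simp add: dom_gam_def gam_eq)

lemma Kn_eq: "n \<ge> 1 \<Longrightarrow> Kn a \<epsilon> R n = {z \<in> gamma_dom a \<epsilon> n. gamma_map a \<epsilon> n z \<in> Bn R n}"
  by (auto simp: Kn_def gam_eq simp del: split_paired_Ex)

lemma gamma_dom_antimono: "m \<le> n \<Longrightarrow> gamma_dom a \<epsilon> n \<subseteq> gamma_dom a \<epsilon> m"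
  by (induction n rule: dec_induct) auto

lemma gamma_dom_first_exit:
  assumes "z \<notin> gamma_dom a \<epsilon> n"
  obtains j where "j < n" "z \<in> gamma_dom a \<epsilon> j" "z \<notin> gamma_dom a \<epsilon> (Suc j)"
  using assms
proof (induction n)
  case (Suc n)
  then show ?case
    by (cases "z \<in> gamma_dom a \<epsilon> n") (auto intro: less_SucI)
qed simp

lemma holo2_on_gamma_map: "holo2_on (gamma_map a \<epsilon> n) (gamma_dom a \<epsilon> n)"
proof (induction n)
  case 0
  then show ?case by (simp add: holo2_on_def)
next
  case (Suc n)
  have "holo2_on (gamma_map a \<epsilon> n) (gamma_dom a \<epsilon> (Suc n))"
    using Suc.IH by (rule holo2_on_subset) auto
  then show ?case
    unfolding gamma_map_Suc_eq by (rule holo2_on_shear) simp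
qed

lemma open_gamma_dom: "open (gamma_dom a \<epsilon> n)"
proof (induction n)
  case 0
  then show ?case by simp
next
  case (Suc n)
  have "continuous_on (gamma_dom a \<epsilon> n) (\<lambda>z. pole_coord (Suc n) (gamma_map a \<epsilon> n z))"
    using holo2_on_coord(1)[OF holo2_on_gamma_map] by (rule holomorphic_on_imp_continuous_on)
  then have "open (gamma_dom a \<epsilon> n \<inter> (\<lambda>z. pole_coord (Suc n) (gamma_map a \<epsilon> n z)) -` (- {a (Suc n)}))"
    using Suc.IH by (intro continuous_open_preimage) auto
  moreover have "gamma_dom a \<epsilon> (Suc n)
      = gamma_dom a \<epsilon> n \<inter> (\<lambda>z. pole_coord (Suc n) (gamma_map a \<epsilon> n z)) -` (- {a (Suc n)})"
    by auto
  ultimately show ?case by simp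
qed

lemma embedding_on_gamma_map: "embedding_on (gamma_map a \<epsilon> n) (gamma_dom a \<epsilon> n)"
proof (induction n)
  case 0
  then show ?case by (simp add: embedding_on_def inj_on_def)
next
  case (Suc n)
  have sub: "gamma_dom a \<epsilon> (Suc n) \<subseteq> gamma_dom a \<epsilon> n"
    by auto
  have "embedding_on (\<lambda>z. shear a \<epsilon> (Suc n) (gamma_map a \<epsilon> n z)) (gamma_dom a \<epsilon> (Suc n))"
  proof (rule embedding_on_shear)
    show "holo2_on (gamma_map a \<epsilon> n) (gamma_dom a \<epsilon> (Suc n))"
      using holo2_on_gamma_map sub by (rule holo2_on_subset)
    show "embedding_on (gamma_map a \<epsilon> n) (gamma_dom a \<epsilon> (Suc n))"
      using Suc.IH sub by (rule embedding_on_subset)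
  qed (use open_gamma_dom[of a \<epsilon> "Suc n"] in auto)
  then show ?case
    by (simp only: gamma_map_Suc_eq)
qed

section \<open>Compactness of K_n\<close>

lemma filterlim_at_infinity_norm_le:
  assumes "filterlim f at_infinity F" and "\<And>x. norm (f x) \<le> norm (g x)"
  shows "filterlim g at_infinity F"
  using assms unfolding filterlim_at_infinity_conv_norm_at_top
  by (auto intro: filterlim_at_top_mono)

lemma filterlim_at_infinity_diff_const:
  fixes c :: "'a::real_normed_vector"
  shows "filterlim f at_infinity F \<Longrightarrow> filterlim (\<lambda>x. f x - c) at_infinity F"
  using tendsto_add_filterlim_at_infinity'[of f F "\<lambda>_. - c" "- c"] by simp

lemma bounded_preimage_at_infinity:
  fixes g :: "'a::real_normed_vector \<Rightarrow> 'b::real_normed_vector"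
  assumes "filterlim g at_infinity at_infinity" and "bounded B"
  shows "bounded {z. g z \<in> B}"
proof -
  obtain C where C: "\<And>b. b \<in> B \<Longrightarrow> norm b \<le> C"
    using \<open>bounded B\<close> bounded_iff by blast
  have "eventually (\<lambda>z. C < norm (g z)) at_infinity"
    using assms(1) unfolding filterlim_at_infinity_conv_norm_at_top filterlim_at_top_dense by blast
  then obtain b where b: "\<And>z. b \<le> norm z \<Longrightarrow> C < norm (g z)"
    unfolding eventually_at_infinity by blast
  have "{z. g z \<in> B} \<subseteq> ball 0 b"
  proof
    fix z assume "z \<in> {z. g z \<in> B}"
    then have "\<not> C < norm (g z)"
      using C by (simp add: not_less)
    then show "z \<in> ball 0 b"
      using b[of z] by (cases "b \<le> norm z") auto
  qed
  then show ?thesis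
    using bounded_ball bounded_subset by blast
qed

lemma closed_preimage_proper:
  fixes g :: "'a::topological_space \<Rightarrow> 'b::real_normed_vector"
  assumes cont: "continuous_on S g"
    and boundary: "\<And>z. z \<notin> S \<Longrightarrow> filterlim g at_infinity (at z within S)"
    and "closed B" and "bounded B"
  shows "closed {z \<in> S. g z \<in> B}"
  unfolding closed_limpt
proof (intro allI impI)
  let ?T = "{z \<in> S. g z \<in> B}"
  fix z assume "z islimpt ?T"
  then have nontrivial: "at z within ?T \<noteq> bot"
    using trivial_limit_within by blast
  have in_T: "eventually (\<lambda>w. w \<in> ?T) (at z within ?T)"
    by (simp add: eventually_at_filter)
  show "z \<in> ?T"
  proof (cases "z \<in> S")
    case True
    then have "(g \<longlongrightarrow> g z) (at z within S)"
      using cont by (simp add: continuous_on_def)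
    then have "(g \<longlongrightarrow> g z) (at z within ?T)"
      by (rule tendsto_within_subset) blast
    moreover have "eventually (\<lambda>w. g w \<in> B) (at z within ?T)"
      using in_T by (rule eventually_mono) simp
    ultimately have "g z \<in> B"
      using Lim_in_closed_set[OF \<open>closed B\<close> _ nontrivial] by blast
    then show ?thesis
      using True by simp
  next
    case False
    obtain C where C: "\<And>b. b \<in> B \<Longrightarrow> norm b \<le> C"
      using \<open>bounded B\<close> bounded_iff by blast
    have "filterlim g at_infinity (at z within ?T)"
      using boundary[OF False] by (rule filterlim_within_subset) blast
    then have "eventually (\<lambda>w. C < norm (g w)) (at z within ?T)"
      unfolding filterlim_at_infinity_conv_norm_at_top filterlim_at_top_dense by blast
    with in_T have "eventually (\<lambda>w. False) (at z within ?T)"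
      by eventually_elim (use C in \<open>auto simp: not_less[symmetric]\<close>)
    then show ?thesis
      using nontrivial by (simp add: eventually_False)
  qed
qed

lemma compact_proper_preimage:
  fixes g :: "'a::euclidean_space \<Rightarrow> 'b::real_normed_vector"
  assumes "continuous_on S g" and "filterlim g at_infinity at_infinity"
    and "\<And>z. z \<notin> S \<Longrightarrow> filterlim g at_infinity (at z within S)" and "compact B"
  shows "compact {z \<in> S. g z \<in> B}"
proof -
  have "bounded {z. g z \<in> B}"
    using assms(2,4) by (intro bounded_preimage_at_infinity compact_imp_bounded)
  then have "bounded {z \<in> S. g z \<in> B}"
    by (rule bounded_subset) blast
  moreover have "closed {z \<in> S. g z \<in> B}"
    using assms by (intro closed_preimage_proper compact_imp_closed compact_imp_bounded)
  ultimately show ?thesis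
    by (simp add: compact_eq_bounded_closed)
qed

lemma gamma_map_at_infinity:
  assumes "\<And>k. k \<ge> 1 \<Longrightarrow> a k \<noteq> 0"
  shows "filterlim (\<lambda>z. fst (gamma_map a \<epsilon> n z)) at_infinity at_infinity \<and>
         ((\<lambda>z. snd (gamma_map a \<epsilon> n z)) \<longlongrightarrow> 0) at_infinity"
proof (induction n)
  case 0
  then show ?case by (simp add: filterlim_ident)
next
  case (Suc n)
  then have fst_inf: "filterlim (\<lambda>z. fst (gamma_map a \<epsilon> n z)) at_infinity at_infinity"
    and snd_0: "((\<lambda>z. snd (gamma_map a \<epsilon> n z)) \<longlongrightarrow> 0) at_infinity"
    by auto
  show ?case
  proof (cases "odd (Suc n)")
    case True
    have "((\<lambda>z. snd (gamma_map a \<epsilon> n z) + of_real (\<epsilon> (Suc n)) / (fst (gamma_map a \<epsilon> n z) - a (Suc n)))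
        \<longlongrightarrow> 0 + 0) at_infinity"
      by (intro tendsto_add snd_0 tendsto_divide_0[OF tendsto_const]
          filterlim_at_infinity_diff_const fst_inf)
    then show ?thesis
      using True fst_inf by (simp add: shear_def)
  next
    case False
    have "((\<lambda>z. of_real (\<epsilon> (Suc n)) / (snd (gamma_map a \<epsilon> n z) - a (Suc n)))
        \<longlongrightarrow> of_real (\<epsilon> (Suc n)) / (0 - a (Suc n))) at_infinity"
      using assms[of "Suc n"] by (intro tendsto_intros snd_0) auto
    then have "filterlim (\<lambda>z. fst (gamma_map a \<epsilon> n z) + of_real (\<epsilon> (Suc n)) / (snd (gamma_map a \<epsilon> n z) - a (Suc n)))
        at_infinity at_infinity"
      by (rule tendsto_add_filterlim_at_infinity'[OF fst_inf])
    then show ?thesis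
      using False snd_0 by (simp add: shear_def)
  qed
qed

lemma shear_pole_coord_limits:
  assumes pole: "((\<lambda>z. pole_coord k (g z)) \<longlongrightarrow> c) F"
    and free: "filterlim (\<lambda>z. free_coord k (g z)) at_infinity F" and "c \<noteq> a m"
  shows "((\<lambda>z. pole_coord k (shear a \<epsilon> m (g z))) \<longlongrightarrow> c) F \<and>
         filterlim (\<lambda>z. free_coord k (shear a \<epsilon> m (g z))) at_infinity F"
proof (cases "odd k = odd m")
  case True
  then have pk: "pole_coord k = pole_coord m" and fk: "free_coord k = free_coord m"
    using coord_parity(1) by blast+
  have "((\<lambda>z. of_real (\<epsilon> m) / (pole_coord k (g z) - a m)) \<longlongrightarrow> of_real (\<epsilon> m) / (c - a m)) F"
    using \<open>c \<noteq> a m\<close> by (intro tendsto_intros pole) simp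
  then have "filterlim (\<lambda>z. free_coord k (g z) + of_real (\<epsilon> m) / (pole_coord k (g z) - a m)) at_infinity F"
    by (rule tendsto_add_filterlim_at_infinity'[OF free])
  then show ?thesis
    using pole by (simp add: pk fk)
next
  case False
  then have pk: "pole_coord k = free_coord m" and fk: "free_coord k = pole_coord m"
    using coord_parity(2) by blast+
  have "((\<lambda>z. pole_coord k (g z) + of_real (\<epsilon> m) / (free_coord k (g z) - a m)) \<longlongrightarrow> c + 0) F"
    by (intro tendsto_add pole tendsto_divide_0[OF tendsto_const] filterlim_at_infinity_diff_const free)
  then show ?thesis
    using free by (simp add: pk fk)
qed

lemma gamma_map_at_first_pole:
  assumes \<epsilon>: "\<epsilon> (Suc j) \<noteq> 0"
    and z0: "z0 \<in> gamma_dom a \<epsilon> j" "z0 \<notin> gamma_dom a \<epsilon> (Suc j)"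
    and S: "S \<subseteq> gamma_dom a \<epsilon> (Suc j)"
  shows "((\<lambda>z. pole_coord (Suc j) (gamma_map a \<epsilon> (Suc j) z)) \<longlongrightarrow> a (Suc j)) (at z0 within S) \<and>
         filterlim (\<lambda>z. free_coord (Suc j) (gamma_map a \<epsilon> (Suc j) z)) at_infinity (at z0 within S)"
proof -
  let ?k = "Suc j" and ?F = "at z0 within S"
  let ?P = "\<lambda>z. pole_coord ?k (gamma_map a \<epsilon> j z)" and ?Q = "\<lambda>z. free_coord ?k (gamma_map a \<epsilon> j z)"
  have "S \<subseteq> gamma_dom a \<epsilon> j"
    using S by auto
  moreover have "continuous_on (gamma_dom a \<epsilon> j) ?P" "continuous_on (gamma_dom a \<epsilon> j) ?Q"
    using holo2_on_coord[OF holo2_on_gamma_map] by (auto intro: holomorphic_on_imp_continuous_on)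
  ultimately have "(?P \<longlongrightarrow> ?P z0) ?F" "(?Q \<longlongrightarrow> ?Q z0) ?F"
    using z0(1) by (auto simp: continuous_on_def intro: tendsto_within_subset)
  moreover have "?P z0 = a ?k"
    using z0 by simp
  ultimately have P_lim: "(?P \<longlongrightarrow> a ?k) ?F" and Q_lim: "(?Q \<longlongrightarrow> ?Q z0) ?F"
    by simp_all
  have "eventually (\<lambda>z. z \<in> S) ?F"
    by (simp add: eventually_at_filter)
  then have "eventually (\<lambda>z. ?P z - a ?k \<noteq> 0) ?F"
    by (rule eventually_mono) (use S in auto)
  then have "filterlim (\<lambda>z. ?P z - a ?k) (at 0) ?F"
    using LIM_zero[OF P_lim] by (simp add: filterlim_atI)
  then have "filterlim (\<lambda>z. of_real (\<epsilon> ?k) / (?P z - a ?k)) at_infinity ?F"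
    using \<epsilon> by (intro filterlim_divide_at_infinity[OF tendsto_const]) auto
  then have "filterlim (\<lambda>z. ?Q z + of_real (\<epsilon> ?k) / (?P z - a ?k)) at_infinity ?F"
    by (rule tendsto_add_filterlim_at_infinity[OF Q_lim])
  then show ?thesis
    using P_lim by simp
qed

lemma gamma_map_near_pole:
  assumes a: "inj_on a {1..}" and \<epsilon>: "\<epsilon> (Suc j) \<noteq> 0"
    and z0: "z0 \<in> gamma_dom a \<epsilon> j" "z0 \<notin> gamma_dom a \<epsilon> (Suc j)"
    and S: "S \<subseteq> gamma_dom a \<epsilon> n" and m: "Suc j \<le> m" "m \<le> n"
  shows "((\<lambda>z. pole_coord (Suc j) (gamma_map a \<epsilon> m z)) \<longlongrightarrow> a (Suc j)) (at z0 within S) \<and>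
         filterlim (\<lambda>z. free_coord (Suc j) (gamma_map a \<epsilon> m z)) at_infinity (at z0 within S)"
  using m(1)
proof (induction m rule: dec_induct)
  case base
  have "S \<subseteq> gamma_dom a \<epsilon> (Suc j)"
    using S gamma_dom_antimono[of "Suc j" n a \<epsilon>] m by simp
  then show ?case
    by (rule gamma_map_at_first_pole[OF \<epsilon> z0])
next
  case (step m)
  have "a (Suc j) \<noteq> a (Suc m)"
    using a step.hyps by (auto dest: inj_onD)
  with step.IH show ?case
    unfolding gamma_map.simps by (intro shear_pole_coord_limits) auto
qed

lemma gamma_map_at_boundary:
  assumes "inj_on a {1..}" and "\<And>k. k \<in> {1..n} \<Longrightarrow> \<epsilon> k \<noteq> 0" and "z0 \<notin> gamma_dom a \<epsilon> n"
  shows "filterlim (gamma_map a \<epsilon> n) at_infinity (at z0 within gamma_dom a \<epsilon> n)"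
proof -
  obtain j where j: "j < n" "z0 \<in> gamma_dom a \<epsilon> j" "z0 \<notin> gamma_dom a \<epsilon> (Suc j)"
    using gamma_dom_first_exit[OF assms(3)] by blast
  have "\<epsilon> (Suc j) \<noteq> 0"
    using assms(2) j(1) by simp
  then have "filterlim (\<lambda>z. free_coord (Suc j) (gamma_map a \<epsilon> n z)) at_infinity
      (at z0 within gamma_dom a \<epsilon> n)"
    using gamma_map_near_pole[OF assms(1) _ j(2,3) order_refl, of n] j(1) by auto
  then show ?thesis
    by (rule filterlim_at_infinity_norm_le) (rule norm_coord_le)
qed

lemma compact_Kn:
  assumes "\<And>k. k \<ge> 1 \<Longrightarrow> a k \<noteq> 0" and "inj_on a {1..}" and "\<And>k. k \<in> {1..n} \<Longrightarrow> \<epsilon> k \<noteq> 0"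
  shows "compact (Kn a \<epsilon> R n)"
proof (cases "n = 0")
  case True
  then show ?thesis by (simp add: Kn_def)
next
  case False
  have "compact (Bn R n)"
    using False by (simp add: Bn_def Dn_def compact_Times)
  moreover have "filterlim (gamma_map a \<epsilon> n) at_infinity at_infinity"
  proof (rule filterlim_at_infinity_norm_le)
    show "filterlim (\<lambda>z. fst (gamma_map a \<epsilon> n z)) at_infinity at_infinity"
      using gamma_map_at_infinity[of a \<epsilon> n] assms(1) by blast
    show "norm (fst (gamma_map a \<epsilon> n z)) \<le> norm (gamma_map a \<epsilon> n z)" for z
      using norm_fst_le[of "fst (gamma_map a \<epsilon> n z)" "snd (gamma_map a \<epsilon> n z)"] by simp
  qed
  ultimately have "compact {z \<in> gamma_dom a \<epsilon> n. gamma_map a \<epsilon> n z \<in> Bn R n}"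
    using gamma_map_at_boundary[OF assms(2,3)]
    by (intro compact_proper_preimage holo2_on_imp_continuous_on[OF holo2_on_gamma_map])
  then show ?thesis
    using False by (simp add: Kn_eq)
qed

section \<open>The construction\<close>

(* a_n is at distance 1 from B_(n-1) and at distance 1/2 from B_j(1/2) for every j < n. *)
definition poles :: "nat \<Rightarrow> complex" where
  "poles k = of_real (2 * real k - 1)"

definition radii :: "nat \<Rightarrow> real" where
  "radii k = 2 * real k"

lemma norm_poles: "k \<ge> 1 \<Longrightarrow> norm (poles k) = 2 * real k - 1"
  unfolding poles_def norm_of_real by simp

lemma poles_nonzero: "k \<ge> 1 \<Longrightarrow> poles k \<noteq> 0"
  using norm_poles[of k] by auto

lemma inj_poles: "inj poles"
  by (rule injI) (simp add: poles_def)

lemma Bn_radii_subset: "Bn radii j \<subseteq> cball 0 (radii j) \<times> cball 0 (radii j)"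
  by (cases "j = 0") (auto simp: Bn_def Dn_def radii_def)

lemma norm_coord_le_shift:
  fixes p q :: "complex \<times> complex"
  shows "norm (fst q) \<le> norm (fst p) + norm (q - p)" "norm (snd q) \<le> norm (snd p) + norm (q - p)"
  using norm_triangle_sub[of "fst q" "fst p"] norm_triangle_sub[of "snd q" "snd p"]
    dist_fst_le[of q p] dist_snd_le[of q p]
  by (simp_all add: dist_norm)

lemma norm_shear_minus_le:
  assumes "0 < \<rho>" and "\<rho> \<le> norm (pole_coord n p - a n)"
  shows "norm (shear a \<epsilon> n p - p) \<le> \<bar>\<epsilon> n\<bar> / \<rho>"
proof -
  have "norm (shear a \<epsilon> n p - p) = norm (of_real (\<epsilon> n) / (pole_coord n p - a n))"
    by (cases p; cases "odd n") (simp_all add: shear_def pole_coord_def norm_Pair)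
  also have "\<dots> = \<bar>\<epsilon> n\<bar> / norm (pole_coord n p - a n)"
    by (simp add: norm_divide)
  also have "\<dots> \<le> \<bar>\<epsilon> n\<bar> / \<rho>"
    using assms by (intro divide_left_mono mult_pos_pos) auto
  finally show ?thesis .
qed

lemma shear_poles_near_identity:
  assumes "n \<ge> 1" and "0 < \<rho>"
    and "norm (fst p) \<le> 2 * real n - 1 - \<rho>" and "norm (snd p) \<le> 2 * real n - 1 - \<rho>"
  shows "pole_coord n p \<noteq> poles n" and "norm (shear poles \<epsilon> n p - p) \<le> \<bar>\<epsilon> n\<bar> / \<rho>"
proof -
  have "norm (pole_coord n p) \<le> 2 * real n - 1 - \<rho>"
    using assms by (simp add: pole_coord_def)
  then have far: "\<rho> \<le> norm (pole_coord n p - poles n)"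
    using norm_poles[OF \<open>n \<ge> 1\<close>] norm_triangle_ineq2[of "poles n" "pole_coord n p"]
    by (simp add: norm_minus_commute)
  then show "pole_coord n p \<noteq> poles n"
    using \<open>0 < \<rho>\<close> by auto
  show "norm (shear poles \<epsilon> n p - p) \<le> \<bar>\<epsilon> n\<bar> / \<rho>"
    using \<open>0 < \<rho>\<close> far by (rule norm_shear_minus_le)
qed

lemma Kn_subset_interior_next:
  assumes "n \<ge> 2" and "\<bar>\<epsilon> n\<bar> \<le> 1"
  shows "Kn poles \<epsilon> radii (n - 1)
    \<subseteq> {z \<in> gamma_dom poles \<epsilon> n. gamma_map poles \<epsilon> n z \<in> ball 0 (radii n) \<times> ball 0 (radii n)}"
proof
  fix z assume z: "z \<in> Kn poles \<epsilon> radii (n - 1)"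
  obtain j where n: "n = Suc j" and "j \<ge> 1"
    using assms(1) by (cases n) auto
  let ?p = "gamma_map poles \<epsilon> j z" and ?q = "gamma_map poles \<epsilon> n z"
  have "z \<in> gamma_dom poles \<epsilon> j" and "?p \<in> Bn radii j"
    using z Kn_eq[OF \<open>j \<ge> 1\<close>] n by auto
  then have "norm (fst ?p) \<le> 2 * real n - 1 - 1" "norm (snd ?p) \<le> 2 * real n - 1 - 1"
    using Bn_radii_subset[of j] n by (auto simp: radii_def)
  note near = shear_poles_near_identity[OF _ zero_less_one this]
  have "z \<in> gamma_dom poles \<epsilon> n"
    using near(1) \<open>z \<in> gamma_dom poles \<epsilon> j\<close> n by simp
  moreover have "norm (?q - ?p) \<le> 1"
    using near(2)[of \<epsilon>] assms n by simp
  then have "norm (fst ?q) < radii n" "norm (snd ?q) < radii n"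
    using norm_coord_le_shift[of ?q ?p] \<open>norm (fst ?p) \<le> _\<close> \<open>norm (snd ?p) \<le> _\<close>
    by (simp_all add: radii_def)
  ultimately show "z \<in> {w \<in> gamma_dom poles \<epsilon> n.
      gamma_map poles \<epsilon> n w \<in> ball 0 (radii n) \<times> ball 0 (radii n)}"
    by (simp add: mem_Times_iff)
qed

definition embedding_margin :: "(nat \<Rightarrow> real) \<Rightarrow> nat \<Rightarrow> real \<Rightarrow> bool" where
  "embedding_margin \<epsilon> n \<delta> \<longleftrightarrow>
     (\<forall>h. holo2_on h (dom_gam poles \<epsilon> n) \<and>
          (SUP z\<in>Kn poles \<epsilon> radii n. ereal (norm (the (gam poles \<epsilon> n z) - h z))) < ereal \<delta>
          \<longrightarrow> embedding_on h (Kn poles \<epsilon> radii (n - 1)))"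

lemma embedding_margin_mono: "embedding_margin \<epsilon> n \<delta> \<Longrightarrow> \<delta>' \<le> \<delta> \<Longrightarrow> embedding_margin \<epsilon> n \<delta>'"
  unfolding embedding_margin_def by (meson ereal_less_eq(3) order_less_le_trans)

lemma gam_cong: "(\<And>k. k \<in> {1..n} \<Longrightarrow> \<epsilon> k = \<epsilon>' k) \<Longrightarrow> gam a \<epsilon> n = gam a \<epsilon>' n"
proof (induction n)
  case (Suc n)
  then have "gam a \<epsilon> n = gam a \<epsilon>' n" and "fmap a \<epsilon> (Suc n) = fmap a \<epsilon>' (Suc n)"
    by (auto simp: fmap_def fun_eq_iff)
  then show ?case
    by (intro ext) simp
qed (simp add: fun_eq_iff)

lemma embedding_margin_cong:
  assumes "\<And>k. k \<in> {1..n} \<Longrightarrow> \<epsilon> k = \<epsilon>' k"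
  shows "embedding_margin \<epsilon> n \<delta> \<longleftrightarrow> embedding_margin \<epsilon>' n \<delta>"
proof -
  have "gam poles \<epsilon> n = gam poles \<epsilon>' n" "gam poles \<epsilon> (n - 1) = gam poles \<epsilon>' (n - 1)"
    using assms by (auto intro!: gam_cong)
  then show ?thesis
    unfolding embedding_margin_def dom_gam_def Kn_def by simp
qed

lemma compact_Kn_poles:
  assumes "\<And>k. k \<in> {1..n} \<Longrightarrow> \<epsilon> k \<noteq> 0"
  shows "compact (Kn poles \<epsilon> radii n)"
  by (rule compact_Kn[OF poles_nonzero inj_on_subset[OF inj_poles subset_UNIV] assms])

lemma Kn_pred_thickening:
  assumes "n \<ge> 2" and \<epsilon>: "\<And>k. k \<in> {1..n} \<Longrightarrow> 0 < \<epsilon> k \<and> \<epsilon> k \<le> 1"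
  obtains r where "r > 0" and "(\<Union>z\<in>Kn poles \<epsilon> radii (n - 1). cball z r) \<subseteq> Kn poles \<epsilon> radii n"
proof -
  let ?K = "Kn poles \<epsilon> radii (n - 1)" and ?U = "gamma_dom poles \<epsilon> n"
  let ?O = "{z \<in> ?U. gamma_map poles \<epsilon> n z \<in> ball 0 (radii n) \<times> ball 0 (radii n)}"
  have "\<epsilon> k \<noteq> 0" if "k \<in> {1..n - 1}" for k
  proof -
    have "k \<in> {1..n}"
      using that by auto
    then show ?thesis
      using \<epsilon>[of k] by simp
  qed
  then have "compact ?K"
    by (rule compact_Kn_poles)
  have "?O = ?U \<inter> gamma_map poles \<epsilon> n -` (ball 0 (radii n) \<times> ball 0 (radii n))"
    by blast
  moreover have "open (?U \<inter> gamma_map poles \<epsilon> n -` (ball 0 (radii n) \<times> ball 0 (radii n)))"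
    by (intro continuous_open_preimage holo2_on_imp_continuous_on holo2_on_gamma_map open_gamma_dom
        open_Times open_ball)
  ultimately have "open ?O"
    by simp
  have "?K \<subseteq> ?O"
    using \<open>n \<ge> 2\<close> \<epsilon>[of n] by (intro Kn_subset_interior_next) auto
  then obtain r where "r > 0" and r: "(\<Union>z\<in>?K. cball z r) \<subseteq> ?O"
    using compact_subset_open_imp_cball_epsilon_subset[OF \<open>compact ?K\<close> \<open>open ?O\<close>] by blast
  moreover have "?O \<subseteq> Kn poles \<epsilon> radii n"
    using \<open>n \<ge> 2\<close> by (auto simp: Kn_eq Bn_def Dn_def mem_Times_iff radii_def)
  ultimately show thesis
    using that by blast
qed

lemma embedding_marginI:
  assumes "n \<ge> 1"
    and \<delta>: "\<And>h. holo2_on h (gamma_dom poles \<epsilon> n) \<Longrightarrow>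
      (\<And>z. z \<in> Kn poles \<epsilon> radii n \<Longrightarrow> norm (gamma_map poles \<epsilon> n z - h z) < \<delta>) \<Longrightarrow>
      embedding_on h (Kn poles \<epsilon> radii (n - 1))"
  shows "embedding_margin \<epsilon> n \<delta>"
  unfolding embedding_margin_def
proof (intro allI impI)
  fix h assume h: "holo2_on h (dom_gam poles \<epsilon> n) \<and>
    (SUP z\<in>Kn poles \<epsilon> radii n. ereal (norm (the (gam poles \<epsilon> n z) - h z))) < ereal \<delta>"
  then have "holo2_on h (gamma_dom poles \<epsilon> n)"
    by (simp add: dom_gam_eq)
  moreover have "norm (gamma_map poles \<epsilon> n z - h z) < \<delta>" if "z \<in> Kn poles \<epsilon> radii n" for z
  proof -
    have "the (gam poles \<epsilon> n z) = gamma_map poles \<epsilon> n z"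
      using that \<open>n \<ge> 1\<close> by (simp add: gam_eq Kn_eq)
    then show ?thesis
      using SUP_lessD[OF h[THEN conjunct2] that] by simp
  qed
  ultimately show "embedding_on h (Kn poles \<epsilon> radii (n - 1))"
    by (rule \<delta>)
qed

lemma embedding_margin_exists:
  assumes "n \<ge> 1" and \<epsilon>: "\<And>k. k \<in> {1..n} \<Longrightarrow> 0 < \<epsilon> k \<and> \<epsilon> k \<le> 1"
  obtains \<delta> where "\<delta> > 0" and "embedding_margin \<epsilon> n \<delta>"
proof (cases "n = 1")
  case True
  then show ?thesis
    using that[of 1] by (simp add: embedding_margin_def Kn_def embedding_on_def)
next
  case False
  let ?K = "Kn poles \<epsilon> radii (n - 1)" and ?L = "Kn poles \<epsilon> radii n" and ?U = "gamma_dom poles \<epsilon> n"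
  obtain r where "r > 0" and KL: "(\<Union>z\<in>?K. cball z r) \<subseteq> ?L"
    using Kn_pred_thickening[of n \<epsilon>] assms False by force
  have "\<epsilon> k \<noteq> 0" if "k \<in> {1..n - 1}" for k
  proof -
    have "k \<in> {1..n}"
      using that by auto
    then show ?thesis
      using \<epsilon>[of k] by simp
  qed
  then have "compact ?K"
    by (rule compact_Kn_poles)
  have "?L \<subseteq> ?U"
    using \<open>n \<ge> 1\<close> by (auto simp: Kn_eq)
  moreover have "?K \<subseteq> (\<Union>z\<in>?K. cball z r)"
    using \<open>r > 0\<close> by auto
  ultimately have "embedding_on (gamma_map poles \<epsilon> n) ?K"
    using embedding_on_gamma_map KL by (meson embedding_on_subset subset_trans)
  then obtain \<delta> where "\<delta> > 0" and "embedding_margin \<epsilon> n \<delta>"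
    using embedding_on_perturbation[OF holo2_on_gamma_map open_gamma_dom \<open>compact ?K\<close> \<open>r > 0\<close> KL \<open>?L \<subseteq> ?U\<close>]
      embedding_marginI[OF \<open>n \<ge> 1\<close>] by metis
  then show ?thesis
    using that by blast
qed

(* margins n holds delta_0, ..., delta_n (later entries are the placeholder 1/4); step n + 1 fixes
   eps_(n+1) = delta_n / 2^(2n+3), which makes 2 eps_(n+1) < delta_j / 2^(j+n+1) for j <= n,
   and then picks delta_(n+1). *)
definition eps_of :: "(nat \<Rightarrow> real) \<Rightarrow> nat \<Rightarrow> real" where
  "eps_of \<delta> k = \<delta> (k - 1) / 2 ^ (2 * k + 1)"

definition next_margin :: "(nat \<Rightarrow> real) \<Rightarrow> nat \<Rightarrow> real" where
  "next_margin \<delta> n = (SOME \<mu>. \<mu> > 0 \<and> embedding_margin (eps_of \<delta>) n \<mu>)"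

primrec margins :: "nat \<Rightarrow> nat \<Rightarrow> real" where
  "margins 0 = (\<lambda>_. 1 / 4)"
| "margins (Suc n) = (margins n)(Suc n := min (margins n n / 2) (next_margin (margins n) (Suc n)))"

definition margin :: "nat \<Rightarrow> real" where
  "margin k = margins k k"

definition shear_eps :: "nat \<Rightarrow> real" where
  "shear_eps = eps_of margin"

lemma eps_of_bounds:
  assumes "0 < \<delta> (k - 1)" and "\<delta> (k - 1) \<le> 1 / 4"
  shows "0 < eps_of \<delta> k" and "eps_of \<delta> k \<le> 1"
proof -
  have "(1::real) \<le> 2 ^ (2 * k + 1)"
    by (rule one_le_power) simp
  then have "eps_of \<delta> k \<le> \<delta> (k - 1)"
    using assms(1) unfolding eps_of_def by (simp add: divide_le_eq)
  then show "eps_of \<delta> k \<le> 1"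
    using assms(2) by simp
  show "0 < eps_of \<delta> k"
    using assms(1) by (simp add: eps_of_def)
qed

lemma next_margin_spec:
  assumes "n \<ge> 1" and "\<And>k. 0 < \<delta> k \<and> \<delta> k \<le> 1 / 4"
  shows "0 < next_margin \<delta> n \<and> embedding_margin (eps_of \<delta>) n (next_margin \<delta> n)"
proof -
  obtain \<mu> where "\<mu> > 0" "embedding_margin (eps_of \<delta>) n \<mu>"
    using embedding_margin_exists[OF \<open>n \<ge> 1\<close>, of "eps_of \<delta>"] eps_of_bounds assms(2) by blast
  then show ?thesis
    unfolding next_margin_def by (rule someI[where P = "\<lambda>\<mu>. \<mu> > 0 \<and> _ \<mu>", OF conjI])
qed

lemma margins_bounds: "0 < margins n k \<and> margins n k \<le> 1 / 4"
proof (induction n arbitrary: k)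
  case (Suc n)
  then have "0 < next_margin (margins n) (Suc n)"
    using next_margin_spec[of "Suc n" "margins n"] by simp
  then show ?case
    using Suc.IH[of k] Suc.IH[of n] by auto
qed simp

lemma margins_stable:
  assumes "k \<le> n" and "n \<le> m"
  shows "margins m k = margins n k"
  using assms(2) by (induction m rule: dec_induct) (use assms(1) in auto)

lemma margins_eq_margin: "k \<le> n \<Longrightarrow> margins n k = margin k"
  using margins_stable[of k k n] by (simp add: margin_def)

lemma margin_pos: "0 < margin k"
  using margins_bounds by (simp add: margin_def)

lemma margin_Suc_less: "margin (Suc k) < margin k"
  using margin_pos[of k] by (simp add: margin_def)

lemma margin_antimono: "j \<le> m \<Longrightarrow> margin m \<le> margin j"
  using lift_Suc_antimono_le[of margin] margin_Suc_less less_imp_le by blast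

lemma embedding_margin_margin:
  assumes "n \<ge> 1"
  shows "embedding_margin shear_eps n (margin n)"
proof -
  obtain j where n: "n = Suc j"
    using assms by (cases n) auto
  have "embedding_margin (eps_of (margins j)) n (next_margin (margins j) n)"
    using next_margin_spec[OF assms] margins_bounds by blast
  moreover have "margin n \<le> next_margin (margins j) n"
    by (simp add: margin_def n)
  ultimately have "embedding_margin (eps_of (margins j)) n (margin n)"
    by (rule embedding_margin_mono)
  moreover have "eps_of (margins j) k = shear_eps k" if "k \<in> {1..n}" for k
  proof -
    have "k - 1 \<le> j"
      using that n by auto
    then show ?thesis
      by (simp add: eps_of_def shear_eps_def margins_eq_margin)
  qed
  ultimately show ?thesis
    using embedding_margin_cong by blast
qed

lemma closure_nbhd_near:
  assumes "closed B" and "B \<noteq> {}" and "p \<in> closure (nbhd B \<rho>)"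
  obtains b where "b \<in> B" and "dist p b \<le> \<rho>"
proof -
  have "closure (nbhd B \<rho>) \<subseteq> {p. infdist p B \<le> \<rho>}"
  proof (rule closure_minimal)
    show "nbhd B \<rho> \<subseteq> {p. infdist p B \<le> \<rho>}"
      by (auto simp: nbhd_def)
    show "closed {p. infdist p B \<le> \<rho>}"
      by (intro closed_Collect_le continuous_on_infdist continuous_on_id continuous_on_const)
  qed
  then have "infdist p B \<le> \<rho>"
    using assms(3) by blast
  moreover obtain b where "b \<in> B" "infdist p B = dist p b"
    using infdist_attains_inf[OF assms(1,2)] by blast
  ultimately show ?thesis
    using that by simp
qed

lemma fmap_displacement_le:
  assumes "j < n"
  shows "(SUP p\<in>closure (nbhd (Bn radii j) (1/2)).
           (case fmap poles \<epsilon> n p of None \<Rightarrow> (\<infinity> :: ereal) | Some q \<Rightarrow> ereal (norm (q - p))))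
         \<le> ereal (2 * \<bar>\<epsilon> n\<bar>)"
proof (rule SUP_least)
  fix p assume p: "p \<in> closure (nbhd (Bn radii j) (1/2))"
  have "closed (Bn radii j)"
    by (simp add: Bn_def closed_Times)
  moreover have "(0, 0) \<in> Bn radii j"
    by (simp add: Bn_def Dn_def radii_def)
  ultimately obtain b where "b \<in> Bn radii j" and "dist p b \<le> 1/2"
    using closure_nbhd_near p by blast
  then have coords: "norm (fst p) \<le> 2 * real n - 1 - 1/2" "norm (snd p) \<le> 2 * real n - 1 - 1/2"
    using Bn_radii_subset[of j] norm_coord_le_shift[of p b] \<open>j < n\<close>
    by (auto simp: radii_def dist_norm)
  have "n \<ge> 1" "(0::real) < 1/2"
    using \<open>j < n\<close> by auto
  note near = shear_poles_near_identity[OF this coords]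
  show "(case fmap poles \<epsilon> n p of None \<Rightarrow> \<infinity> | Some q \<Rightarrow> ereal (norm (q - p))) \<le> ereal (2 * \<bar>\<epsilon> n\<bar>)"
    using near(1) near(2)[of \<epsilon>] by (simp add: fmap_eq_shear mult.commute)
qed

lemma shear_eps_displacement:
  assumes "j < n"
  shows "(SUP p\<in>closure (nbhd (Bn radii j) (1/2)).
           (case fmap poles shear_eps n p of None \<Rightarrow> (\<infinity> :: ereal) | Some q \<Rightarrow> ereal (norm (q - p))))
         < ereal (margin j / 2 ^ (j + n))"
proof -
  have "2 * \<bar>shear_eps n\<bar> = margin (n - 1) / 2 ^ (2 * n)"
    using margin_pos[of "n - 1"] by (simp add: shear_eps_def eps_of_def)
  also have "\<dots> \<le> margin j / 2 ^ (2 * n)"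
    using margin_antimono[of j "n - 1"] assms by (intro divide_right_mono) auto
  also have "\<dots> < margin j / 2 ^ (j + n)"
    using margin_pos[of j] assms by (intro divide_strict_left_mono power_strict_increasing) auto
  finally show ?thesis
    using fmap_displacement_le[OF assms, of shear_eps] by (simp add: order_le_less_trans)
qed

theorem proposition3p3:
  shows "\<exists>(a :: nat \<Rightarrow> complex) (\<epsilon> :: nat \<Rightarrow> real) (R :: nat \<Rightarrow> real) (\<delta> :: nat \<Rightarrow> real).
    (\<forall>n\<ge>1. \<epsilon> n > 0 \<and> R n > 0) \<and> R 0 = 0 \<and>
    (\<forall>n\<ge>1. R (n - 1) < norm (a n) \<and> norm (a n) < R n) \<and>
    (\<forall>n. \<delta> n > 0) \<and> (\<forall>n. \<delta> (Suc n) < \<delta> n) \<and> \<delta> 0 = 1/4 \<and>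
    (\<forall>n\<ge>1.
       (\<forall>h :: complex \<Rightarrow> complex \<times> complex.
          holo2_on h (dom_gam a \<epsilon> n) \<and>
          (SUP z\<in>Kn a \<epsilon> R n. ereal (norm (the (gam a \<epsilon> n z) - h z))) < ereal (\<delta> n)
          \<longrightarrow> embedding_on h (Kn a \<epsilon> R (n - 1))) \<and>
       (\<forall>j<n. (SUP p\<in>closure (nbhd (Bn R j) (1/2)).
                 (case fmap a \<epsilon> n p of None \<Rightarrow> (\<infinity> :: ereal) | Some q \<Rightarrow> ereal (norm (q - p))))
              < ereal (\<delta> j / 2 ^ (j + n))))"
proof -
  have "\<forall>n\<ge>1. shear_eps n > 0 \<and> radii n > 0"
    using margin_pos by (simp add: shear_eps_def eps_of_def radii_def)
  moreover have "\<forall>n\<ge>1. radii (n - 1) < norm (poles n) \<and> norm (poles n) < radii n"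
    by (simp add: norm_poles radii_def)
  moreover have "\<forall>n\<ge>1.
       (\<forall>h :: complex \<Rightarrow> complex \<times> complex.
          holo2_on h (dom_gam poles shear_eps n) \<and>
          (SUP z\<in>Kn poles shear_eps radii n. ereal (norm (the (gam poles shear_eps n z) - h z)))
            < ereal (margin n)
          \<longrightarrow> embedding_on h (Kn poles shear_eps radii (n - 1))) \<and>
       (\<forall>j<n. (SUP p\<in>closure (nbhd (Bn radii j) (1/2)).
                 (case fmap poles shear_eps n p of None \<Rightarrow> (\<infinity> :: ereal) | Some q \<Rightarrow> ereal (norm (q - p))))
              < ereal (margin j / 2 ^ (j + n)))"
    using embedding_margin_margin shear_eps_displacement unfolding embedding_margin_def by blast
  ultimately show ?thesis
    using margin_pos margin_Suc_less
    by (intro exI[of _ poles] exI[of _ shear_eps] exI[of _ radii] exI[of _ margin])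
      (simp add: radii_def margin_def)
qed

end
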